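(* Given two full skew trees $T_1$ and $T_2$ each with $n$ internal nodes, the skew rotation distance between $T_1$ and $T_2$ can be computed in time $O(n^2)$.
   Context: A full binary tree is a rooted ordered tree in which every node is either a leaf or an internal node with exactly two children. A full skew tree is a full binary tree in which every internal node has at least one child that is a leaf. A right rotation at an internal node $a$ whose left child $b$ is internal, where $C,D$ are the left and right subtrees of $b$ and $E$ is the right subtree of $a$, replaces the subtree rooted at $a$ by the tree with root $b$, left subtree $C$, and right child $a$ whose left and right subtrees are $D$ and $E$; a left rotation is the symmetric (inverse) operation. The skew rotation distance between two full skew trees $T_1,T_2$ with the same number of internal nodes is the minimum number of rotations transforming $T_1$ into $T_2$ such that every intermediate tree in the sequence is also a full skew tree. *)

theory Defs
  imports
    Complex_Main
    "HOL-Library.Tree"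
    "HOL-Library.Extended_Nat"
    "HOL-Library.Landau_Symbols"
begin

section \<open>Full skew trees and the skew rotation distance\<close>

text \<open>Full binary trees are unlabelled: the internal nodes are the \<open>Node\<close> constructors, so
  \<open>size\<close> counts the internal nodes.\<close>

type_synonym full_tree = "unit tree"

fun skew :: "full_tree \<Rightarrow> bool" where
  "skew Leaf \<longleftrightarrow> True"
| "skew (Node l _ r) \<longleftrightarrow> (l = Leaf \<or> r = Leaf) \<and> skew l \<and> skew r"

inductive right_rotation :: "full_tree \<Rightarrow> full_tree \<Rightarrow> bool" where
  here: "right_rotation (Node (Node C b D) a E) (Node C b (Node D a E))"
| in_left: "right_rotation l l' \<Longrightarrow> right_rotation (Node l a r) (Node l' a r)"
| in_right: "right_rotation r r' \<Longrightarrow> right_rotation (Node l a r) (Node l a r')"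

definition left_rotation :: "full_tree \<Rightarrow> full_tree \<Rightarrow> bool" where
  "left_rotation s t \<longleftrightarrow> right_rotation t s"

definition skew_rotation :: "full_tree \<Rightarrow> full_tree \<Rightarrow> bool" where
  "skew_rotation s t \<longleftrightarrow> skew s \<and> skew t \<and> (right_rotation s t \<or> left_rotation s t)"

text \<open>The value is \<open>\<infinity>\<close> if no sequence of rotations through full skew trees exists.\<close>

definition skew_rotation_distance :: "full_tree \<Rightarrow> full_tree \<Rightarrow> enat" where
  "skew_rotation_distance s t = Inf {enat k | k. (skew_rotation ^^ k) s t}"

section \<open>Random access machines\<close>

text \<open>Time is the number of executed instructions of a word RAM whose program is independent of
  the input. The first argument of each arithmetic or load instruction is the target register.
  Arithmetic is on natural numbers, with truncated subtraction; the bound on the word length is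
  imposed in \<open>ram_computes\<close> and excludes overflow. A program uses only finitely many
  registers, since it is a finite list. It halts by leaving its code.\<close>

datatype instr =
    Const nat nat
  | Add nat nat nat
  | Sub nat nat nat
  | Load nat nat
  | Store nat nat
  | Jump nat
  | JumpZero nat nat

type_synonym program = "instr list"

record config =
  pc :: nat
  reg :: "nat \<Rightarrow> nat"
  mem :: "nat \<Rightarrow> nat"

fun exec :: "instr \<Rightarrow> config \<Rightarrow> config" where
  "exec (Const i k) s = s\<lparr>pc := pc s + 1, reg := (reg s)(i := k)\<rparr>"
| "exec (Add i j k) s = s\<lparr>pc := pc s + 1, reg := (reg s)(i := reg s j + reg s k)\<rparr>"
| "exec (Sub i j k) s = s\<lparr>pc := pc s + 1, reg := (reg s)(i := reg s j - reg s k)\<rparr>"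
| "exec (Load i j) s = s\<lparr>pc := pc s + 1, reg := (reg s)(i := mem s (reg s j))\<rparr>"
| "exec (Store i j) s = s\<lparr>pc := pc s + 1, mem := (mem s)(reg s i := reg s j)\<rparr>"
| "exec (Jump l) s = s\<lparr>pc := l\<rparr>"
| "exec (JumpZero i l) s = s\<lparr>pc := (if reg s i = 0 then l else pc s + 1)\<rparr>"

definition halted :: "program \<Rightarrow> config \<Rightarrow> bool" where
  "halted P s \<longleftrightarrow> length P \<le> pc s"

definition step :: "program \<Rightarrow> config \<Rightarrow> config" where
  "step P s = (if halted P s then s else exec (P ! pc s) s)"

definition fits_words :: "nat \<Rightarrow> config \<Rightarrow> bool" where
  "fits_words w s \<longleftrightarrow> (\<forall>i. reg s i < 2 ^ w) \<and> (\<forall>a. mem s a < 2 ^ w)"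

text \<open>Started in \<open>s\<close>, the program \<open>P\<close> halts after at most \<open>t\<close> instructions with \<open>v\<close> in register 0,
  and at all times every register and memory cell holds a word of \<open>w\<close> bits. A halted
  configuration is a fixed point of \<open>step\<close>, whence "at most".\<close>

definition ram_computes :: "program \<Rightarrow> nat \<Rightarrow> nat \<Rightarrow> config \<Rightarrow> nat \<Rightarrow> bool" where
  "ram_computes P w t s v \<longleftrightarrow>
     halted P ((step P ^^ t) s) \<and> reg ((step P ^^ t) s) 0 = v \<and>
     (\<forall>i\<le>t. fits_words w ((step P ^^ i) s))"

section \<open>Linked representation of the input\<close>

text \<open>Each internal node occupies two consecutive cells, the pointers to its left and right child.
  The null pointer 0 stands for a leaf. \<open>cells p t\<close> is the block of the nodes of \<open>t\<close>, in preorder,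
  to be placed at address \<open>p\<close>.\<close>

definition root_ptr :: "nat \<Rightarrow> full_tree \<Rightarrow> nat" where
  "root_ptr p t = (if t = Leaf then 0 else p)"

fun cells :: "nat \<Rightarrow> full_tree \<Rightarrow> nat list" where
  "cells p Leaf = []"
| "cells p (Node l _ r) =
     [root_ptr (p + 2) l, root_ptr (p + 2 + 2 * size l) r] @
     cells (p + 2) l @ cells (p + 2 + 2 * size l) r"

text \<open>Initially, registers 0 and 1 point to the roots of the two trees, whose blocks follow each
  other from address 1 on; everything else is 0.\<close>

definition input_config :: "full_tree \<Rightarrow> full_tree \<Rightarrow> config" where
  "input_config t1 t2 =
     (let q = 1 + 2 * size t1; cs = [0] @ cells 1 t1 @ cells q t2
      in \<lparr>pc = 0,
          reg = (\<lambda>_. 0)(0 := root_ptr 1 t1, 1 := root_ptr q t2),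
          mem = (\<lambda>a. if a < length cs then cs ! a else 0)\<rparr>)"

end

theory Submission
  imports Defs "HOL-Real_Asymp.Real_Asymp"
begin

text \<open>A nonempty full skew tree is determined by its spine, the word that records for each but the
  last internal node whether the next one is its left or its right child. A rotation
  between skew trees exchanges two different adjacent letters of the spine or flips its last letter,
  and so changes exactly one of the numbers \<open>h j\<close> of right turns among the first \<open>j\<close> letters,
  by one. Hence the distance is at least \<open>\<Sum>j. \<bar>h j - h' j\<bar>\<close>. Conversely, if the first letters
  differ, moving the first right turn of the word that starts with a left turn to the front brings the
  words closer by the number of moves spent, so that the bound is attained by induction. A machine
  evaluates the sum by walking down both trees simultaneously, in linear time.\<close>

section \<open>Words under exchanges of adjacent letters\<close>

text \<open>\<open>False\<close> is a left turn and \<open>True\<close> a right turn. The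
  orientation is that of a right rotation; \<open>flip\<close> is the case in which the inner
  subtree \<open>D\<close> is a leaf.\<close>

inductive shift :: "bool list \<Rightarrow> bool list \<Rightarrow> bool" where
  swap: "shift (False # True # u) (True # False # u)"
| flip: "shift [False] [True]"
| cons: "shift u v \<Longrightarrow> shift (a # u) (a # v)"

definition move :: "bool list \<Rightarrow> bool list \<Rightarrow> bool" where
  "move u v \<longleftrightarrow> shift u v \<or> shift v u"

text \<open>The parameter \<open>d\<close> is the surplus of right turns read so far in the first
  word over the second. It is general for the sake of inductions; the distance itself has
  \<open>d = 0\<close>.\<close>

fun profile_dist :: "int \<Rightarrow> bool list \<Rightarrow> bool list \<Rightarrow> nat" where
  "profile_dist d (x # u) (y # v) =
     (let d' = d + of_bool x - of_bool y in nat \<bar>d'\<bar> + profile_dist d' u v)"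
| "profile_dist d _ _ = 0"

lemma profile_dist_Nil2 [simp]: "profile_dist d u [] = 0"
  by (cases u) auto

lemma profile_dist_refl: "profile_dist 0 u u = 0"
  by (induction u) auto

lemma profile_dist_commute: "profile_dist d u v = profile_dist (- d) v u"
proof (induction d u v rule: profile_dist.induct)
  case (1 d x u y v)
  have "- (d + of_bool x - of_bool y) = - d + of_bool y - (of_bool x :: int)"
    by simp
  with 1 [OF refl] show ?case
    by (auto simp: Let_def)
qed auto

text \<open>A pair of letters changes the surplus by at most one, so no summand exceeds
  \<open>b\<close>. The resulting quadratic bound later excludes overflow of the sum.\<close>

lemma profile_dist_le:
  "\<bar>d\<bar> + int (length u) \<le> int b \<Longrightarrow> profile_dist d u v \<le> length u * b"
proof (induction d u v rule: profile_dist.induct)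
  case (1 d x u y v)
  define d' where "d' = d + of_bool x - (of_bool y :: int)"
  have "\<bar>d'\<bar> \<le> \<bar>d\<bar> + 1"
    unfolding d'_def by (cases x; cases y) auto
  then have "\<bar>d'\<bar> + int (length u) \<le> int b"
    using "1.prems" by simp
  moreover from this have "nat \<bar>d'\<bar> \<le> b"
    by linarith
  ultimately show ?case
    using "1.IH" [OF d'_def] by (simp add: Let_def d'_def)
qed auto

section \<open>Lower bound on the number of moves\<close>

lemma shift_length: "shift u v \<Longrightarrow> length u = length v"
  by (induction rule: shift.induct) auto

text \<open>Only one prefix count differs between \<open>u\<close> and \<open>u'\<close>, and by
  one, so a single summand changes.\<close>

lemma profile_dist_shift:
  assumes "shift u u'" "length v = length u"
  shows "profile_dist d u v \<le> Suc (profile_dist d u' v) \<and>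
         profile_dist d u' v \<le> Suc (profile_dist d u v)"
  using assms
proof (induction arbitrary: d v rule: shift.induct)
  case (swap u)
  then obtain y z v' where "v = y # z # v'"
    by (metis length_Suc_conv)
  \<comment> \<open>Once both exchanged letters are read, the surplus passed on to \<open>u\<close>
    is the same in either order.\<close>
  moreover have "d + 1 - a - b = d - a + 1 - b" for a b :: int
    by simp
  ultimately show ?case
    by (auto simp: Let_def algebra_simps)
next
  case flip
  then obtain y where "v = [y]"
    by (auto simp: length_Suc_conv)
  then show ?case
    by (auto simp: Let_def)
next
  case (cons u u' a)
  then obtain y v' where "v = y # v'" "length v' = length u"
    by (auto simp: length_Suc_conv)
  with cons.IH [of v' "d + of_bool a - of_bool y"] show ?case
    by (auto simp: Let_def)
qed

text \<open>No move lowers the profile distance by more than one, and it is 0 when the words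
  agree.\<close>

lemma profile_dist_le_moves:
  "(move ^^ k) u v \<Longrightarrow> length u = length v \<and> profile_dist 0 u v \<le> k"
proof (induction k arbitrary: u)
  case 0
  then show ?case
    by (simp add: profile_dist_refl)
next
  case (Suc k)
  then obtain u' where u': "move u u'" "(move ^^ k) u' v"
    by (meson relpowp_Suc_E2)
  then have "length u = length u'"
    using shift_length by (auto simp: move_def)
  moreover have "length u' = length v"
    using Suc.IH u' by blast
  ultimately show ?case
    using profile_dist_shift [of u u' v 0] profile_dist_shift [of u' u v 0] u' Suc.IH [of u']
    by (fastforce simp: move_def)
qed

section \<open>Upper bound: an optimal sequence of moves\<close>

lemma moves_Cons: "(move ^^ k) u v \<Longrightarrow> (move ^^ k) (a # u) (a # v)"
proof (induction k arbitrary: v)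
  case (Suc k)
  then obtain w where w: "(move ^^ k) u w" "move w v"
    by auto
  then have "move (a # w) (a # v)"
    by (auto simp: move_def intro: shift.cons)
  with Suc.IH [OF w(1)] show ?case
    by auto
qed auto

lemma moves_sym: "(move ^^ k) u v \<Longrightarrow> (move ^^ k) v u"
proof (induction k arbitrary: u)
  case (Suc k)
  then obtain w where w: "move u w" "(move ^^ k) w v"
    by (meson relpowp_Suc_E2)
  then have "move w u"
    by (auto simp: move_def)
  with Suc.IH [OF w(2)] show ?case
    by auto
qed auto

text \<open>The tail that remains after its first right turn has moved in front of the word. A tail
  without right turns is unchanged, as the right turn then arises from a flip of the last
  letter.\<close>

fun del_first :: "bool list \<Rightarrow> bool list" where
  "del_first [] = []"
| "del_first (True # u) = False # u"
| "del_first (False # u) = False # del_first u"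

text \<open>Counted from 1, as this is the number of moves needed to bring the right turn past a
  preceding left turn. If there is none, the flip that creates it counts as well, whence the value 1
  at \<open>[]\<close>.\<close>

fun first_pos :: "bool list \<Rightarrow> nat" where
  "first_pos [] = 1"
| "first_pos (True # u) = 1"
| "first_pos (False # u) = Suc (first_pos u)"

lemma length_del_first [simp]: "length (del_first u) = length u"
  by (induction u rule: del_first.induct) auto

text \<open>The right turn is brought to the front of the tail first and then exchanged with the
  leading left turn.\<close>

lemma moves_bring_to_front: "(move ^^ first_pos v) (False # v) (True # del_first v)"
proof (induction v rule: first_pos.induct)
  case 1
  have "move [False] [True]"
    by (simp add: move_def shift.flip)
  then show ?case
    by (auto intro: relcomppI)
next
  case (2 u)
  have "move (False # True # u) (True # False # u)"
    by (simp add: move_def shift.swap)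
  then show ?case
    by (auto intro: relcomppI)
next
  case (3 u)
  have "(move ^^ first_pos u) (False # False # u) (False # True # del_first u)"
    using 3 by (rule moves_Cons)
  moreover have "move (False # True # del_first u) (True # False # del_first u)"
    by (simp add: move_def shift.swap)
  ultimately show ?case
    by auto
qed

text \<open>Up to the first right turn of \<open>v\<close> the surplus \<open>d + 1\<close> can only
  grow, so it stays positive and each of these summands drops by exactly one; from there on the
  summands agree. The \<open>Suc\<close> is the summand of the leading letters when
  \<open>d = 0\<close>.\<close>

lemma profile_dist_bring_to_front:
  "d \<ge> 0 \<Longrightarrow> length u = length v \<Longrightarrow>
   Suc (profile_dist (d + 1) u v) = first_pos v + profile_dist d u (del_first v)"
proof (induction v arbitrary: d u rule: first_pos.induct)
  case (2 v)
  then show ?case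
    by (cases u) (auto simp: Let_def)
next
  case (3 v)
  then obtain x u' where u: "u = x # u'" "length u' = length v"
    by (metis length_Suc_conv)
  have "Suc (profile_dist (d + of_bool x + 1) u' v) =
        first_pos v + profile_dist (d + of_bool x) u' (del_first v)"
    using 3 u by auto
  moreover have "d + 1 + of_bool x = d + of_bool x + 1"
    by simp
  ultimately show ?case
    using u 3(2) by (cases x) (auto simp: Let_def add.commute nat_add_distrib)
qed auto

lemma moves_profile_dist:
  "length u = length v \<Longrightarrow> (move ^^ profile_dist 0 u v) u v"
proof (induction "length u" arbitrary: u v)
  case 0
  then show ?case
    by simp
next
  case (Suc n)
  \<comment> \<open>It suffices to treat words starting with a right and a left turn, in this order;
    the other order follows by reversing the moves.\<close>
  have ahead: "(move ^^ profile_dist 0 (True # u) (False # v)) (True # u) (False # v)"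
    if "length u = n" "length v = n" for u v
  proof -
    have "(move ^^ profile_dist 0 u (del_first v)) (True # u) (True # del_first v)"
      using Suc.hyps(1) [of u "del_first v"] that by (intro moves_Cons) auto
    \<comment> \<open>The route passes through \<open>True # del_first v\<close>, from which
      \<open>False # v\<close> is reached by bringing the right turn to the front in
      reverse.\<close>
    with moves_sym [OF moves_bring_to_front [of v]]
    have "(move ^^ (profile_dist 0 u (del_first v) + first_pos v)) (True # u) (False # v)"
      by (auto simp: relpowp_add)
    then show ?thesis
      using profile_dist_bring_to_front [of 0 u v] that
      by (simp add: add.commute)
  qed
  from Suc obtain x u' y v' where uv: "u = x # u'" "v = y # v'" "length u' = n" "length v' = n"
    by (metis length_Suc_conv)
  show ?case
  proof (cases "x = y")
    case True
    then show ?thesis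
      using Suc.hyps(1) [of u' v'] uv by (auto intro: moves_Cons)
  next
    case False
    then show ?thesis
      using uv ahead [of u' v'] moves_sym [OF ahead [of v' u']]
        profile_dist_commute [of 0 u v]
      by (cases x) auto
  qed
qed

section \<open>Spines of skew trees\<close>

text \<open>The empty tree and the single node both have the spine \<open>[]\<close>, so only
  nonempty trees can be recovered.\<close>

fun spine :: "full_tree \<Rightarrow> bool list" where
  "spine Leaf = []"
| "spine (Node l _ r) =
     (if l \<noteq> Leaf then False # spine l else if r \<noteq> Leaf then True # spine r else [])"

fun tree_of :: "bool list \<Rightarrow> full_tree" where
  "tree_of [] = Node Leaf () Leaf"
| "tree_of (False # u) = Node (tree_of u) () Leaf"
| "tree_of (True # u) = Node Leaf () (tree_of u)"

lemma length_spine: "skew t \<Longrightarrow> length (spine t) = size t - 1"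
  by (induction t) (auto simp flip: eq_size_0)

lemma tree_of_spine: "skew t \<Longrightarrow> t \<noteq> Leaf \<Longrightarrow> tree_of (spine t) = t"
  by (induction t) auto

lemma skew_tree_of: "skew (tree_of u)"
  by (induction u rule: tree_of.induct) auto

text \<open>Skewness before and after the rotation forces \<open>C\<close> and \<open>E\<close> to
  be leaves; then \<open>D\<close> decides between \<open>swap\<close> and \<open>flip\<close>. That
  neither tree is a leaf ensures that a rotation further down leaves the letters above it
  unchanged.\<close>

lemma shift_spine_if_right_rotation:
  "right_rotation s t \<Longrightarrow> skew s \<Longrightarrow> skew t \<Longrightarrow> s \<noteq> Leaf \<and> t \<noteq> Leaf \<and> shift (spine s) (spine t)"
  by (induction rule: right_rotation.induct) (auto intro: shift.intros)

lemma right_rotation_tree_of: "shift u v \<Longrightarrow> right_rotation (tree_of u) (tree_of v)"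
proof (induction rule: shift.induct)
  case (cons u v a)
  then show ?case
    by (cases a) (auto intro: right_rotation.intros)
qed (auto intro: right_rotation.intros)

lemma moves_if_skew_rotations:
  "(skew_rotation ^^ k) s t \<Longrightarrow> (move ^^ k) (spine s) (spine t)"
proof (induction k arbitrary: t)
  case (Suc k)
  then obtain r where r: "(skew_rotation ^^ k) s r" "skew_rotation r t"
    by auto
  then have "move (spine r) (spine t)"
    using shift_spine_if_right_rotation
    by (auto simp: skew_rotation_def left_rotation_def move_def)
  with Suc.IH [OF r(1)] show ?case
    by auto
qed auto

lemma skew_rotations_if_moves:
  "(move ^^ k) u v \<Longrightarrow> (skew_rotation ^^ k) (tree_of u) (tree_of v)"
proof (induction k arbitrary: v)
  case (Suc k)
  then obtain w where w: "(move ^^ k) u w" "move w v"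
    by auto
  then have "skew_rotation (tree_of w) (tree_of v)"
    using right_rotation_tree_of
    by (auto simp: skew_rotation_def left_rotation_def move_def skew_tree_of)
  with Suc.IH [OF w(1)] show ?case
    by auto
qed auto

theorem skew_rotation_distance_eq:
  assumes "skew s" "skew t" "size s = size t"
  shows "skew_rotation_distance s t = enat (profile_dist 0 (spine s) (spine t))"
  unfolding skew_rotation_distance_def
proof (intro antisym Inf_lower Inf_greatest)
  let ?d = "profile_dist 0 (spine s) (spine t)"
  have "(skew_rotation ^^ ?d) s t"
  proof (cases "s = Leaf")
    \<comment> \<open>The empty tree is not in the range of \<open>tree_of\<close>.\<close>
    case True
    with assms show ?thesis
      by simp
  next
    case False
    with assms have "t \<noteq> Leaf"
      by (metis eq_size_0)
    have "(move ^^ ?d) (spine s) (spine t)"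
      using assms by (intro moves_profile_dist) (simp add: length_spine)
    from skew_rotations_if_moves [OF this] show ?thesis
      using assms False \<open>t \<noteq> Leaf\<close> by (simp add: tree_of_spine)
  qed
  then show "enat ?d \<in> {enat k |k. (skew_rotation ^^ k) s t}"
    by auto
next
  fix x
  assume "x \<in> {enat k |k. (skew_rotation ^^ k) s t}"
  then show "enat (profile_dist 0 (spine s) (spine t)) \<le> x"
    using moves_if_skew_rotations profile_dist_le_moves by fastforce
qed

section \<open>The machine program\<close>

text \<open>Independent of the preorder layout, so that it passes to the children during the
  walk.\<close>

fun represents :: "(nat \<Rightarrow> nat) \<Rightarrow> nat \<Rightarrow> full_tree \<Rightarrow> bool" where
  "represents m p Leaf \<longleftrightarrow> p = 0"
| "represents m p (Node l _ r) \<longleftrightarrow>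
     p \<noteq> 0 \<and> represents m (m p) l \<and> represents m (m (Suc p)) r"

lemma represents_Leaf_iff: "represents m p t \<Longrightarrow> p = 0 \<longleftrightarrow> t = Leaf"
  by (cases t) auto

lemma length_cells [simp]: "length (cells p t) = 2 * size t"
  by (induction p t rule: cells.induct) auto

text \<open>\<open>0 < p\<close> keeps the root apart from the null pointer. The memory is compared
  relative to \<open>p\<close>, so the hypothesis restricts to the blocks of both subtrees.\<close>

lemma represents_cells:
  assumes "0 < p" "\<And>i. i < 2 * size t \<Longrightarrow> m (p + i) = cells p t ! i"
  shows "represents m (root_ptr p t) t"
  using assms
proof (induction p t rule: cells.induct)
  case (1 p)
  then show ?case
    by (simp add: root_ptr_def)
next
  case (2 p l a r)
  have root: "m p = root_ptr (p + 2) l" "m (Suc p) = root_ptr (p + 2 + 2 * size l) r"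
    using "2.prems"(2) [of 0] "2.prems"(2) [of 1] by auto
  have "represents m (root_ptr (p + 2) l) l"
  proof (rule "2.IH"(1))
    fix i assume "i < 2 * size l"
    then show "m (p + 2 + i) = cells (p + 2) l ! i"
      using "2.prems"(2) [of "2 + i"] by (simp add: nth_append)
  qed simp
  moreover have "represents m (root_ptr (p + 2 + 2 * size l) r) r"
  proof (rule "2.IH"(2))
    fix i assume "i < 2 * size r"
    then show "m (p + 2 + 2 * size l + i) = cells (p + 2 + 2 * size l) r ! i"
      using "2.prems"(2) [of "2 + 2 * size l + i"] by (simp add: nth_append add.assoc)
  qed simp
  ultimately show ?case
    using root "2.prems"(1) by (simp add: root_ptr_def)
qed

text \<open>Every stored pointer is null or leads into the block itself.\<close>

lemma cells_less: "x \<in> set (cells p t) \<Longrightarrow> x < p + 2 * size t"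
proof (induction p t rule: cells.induct)
  case (2 p l a r)
  have "root_ptr (p + 2) l < p + 2 * size (Node l a r)"
    "root_ptr (p + 2 + 2 * size l) r < p + 2 * size (Node l a r)"
    by (auto simp: root_ptr_def neq_Leaf_iff)
  with 2 show ?case
    by fastforce
qed auto

section \<open>Runs of the machine without overflow\<close>

text \<open>Only constants and sums can create larger words: truncated subtraction does not increase
  its minuend, and loads and stores copy words.\<close>

fun no_overflow :: "nat \<Rightarrow> instr \<Rightarrow> config \<Rightarrow> bool" where
  "no_overflow w (Const i k) s \<longleftrightarrow> k < 2 ^ w"
| "no_overflow w (Add i j k) s \<longleftrightarrow> reg s j + reg s k < 2 ^ w"
| "no_overflow w _ s \<longleftrightarrow> True"

lemma fits_words_exec: "fits_words w s \<Longrightarrow> no_overflow w i s \<Longrightarrow> fits_words w (exec i s)"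
  by (cases i) (auto simp: fits_words_def intro: le_less_trans [OF diff_le_self])

lemma step_halted: "halted P s \<Longrightarrow> (step P ^^ t) s = s"
  by (induction t) (auto simp: step_def)

lemma ram_computes_halted:
  "halted P s \<Longrightarrow> fits_words w s \<Longrightarrow> reg s 0 = v \<Longrightarrow> ram_computes P w t s v"
  by (simp add: ram_computes_def step_halted)

lemma ram_computes_Suc:
  assumes "fits_words w s" "ram_computes P w t (step P s) v"
  shows "ram_computes P w (Suc t) s v"
proof -
  have "fits_words w ((step P ^^ i) s)" if "i \<le> Suc t" for i
    using that assms by (cases i) (auto simp: ram_computes_def funpow_Suc_right simp del: funpow.simps)
  then show ?thesis
    using assms(2) by (auto simp: ram_computes_def funpow_Suc_right simp del: funpow.simps)
qed

text \<open>A halted configuration is fixed, so branches of different length can share one time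
  bound.\<close>

lemma ram_computes_mono:
  assumes "ram_computes P w t s v" "t \<le> t'"
  shows "ram_computes P w t' s v"
proof -
  have *: "(step P ^^ i) s = (step P ^^ t) s" if "t \<le> i" for i
  proof -
    have "(step P ^^ i) s = (step P ^^ (i - t)) ((step P ^^ t) s)"
      using that by (metis comp_apply funpow_add le_add_diff_inverse2)
    then show ?thesis
      using assms(1) by (simp add: step_halted ram_computes_def)
  qed
  have "fits_words w ((step P ^^ i) s)" for i
    using assms(1) * [of i] by (cases "i \<le> t") (auto simp: ram_computes_def)
  then show ?thesis
    using assms * [of t'] by (auto simp: ram_computes_def)
qed

text \<open>Registers 0 and 1 hold the current nodes, 3 and 4 the numbers of right turns so far, and 2 the
  sum of their differences; of the two truncated differences added to it in each round, one is 0.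
  Registers 6 and 7 hold the constants 1 and 0.\<close>

definition walk_program :: program where
  "walk_program =
    [JumpZero 0 22,
     Const 6 1,
     Load 5 0, JumpZero 5 6, Add 0 5 7, Jump 10,
     Add 0 0 6, Load 0 0, JumpZero 0 22, Add 3 3 6,
     Load 5 1, JumpZero 5 14, Add 1 5 7, Jump 17,
     Add 1 1 6, Load 1 1, Add 4 4 6,
     Sub 5 3 4, Add 2 2 5, Sub 5 4 3, Add 2 2 5, Jump 2,
     Add 0 2 7]"

lemma length_walk_program [simp]: "length walk_program = 23"
  by (simp add: walk_program_def)

text \<open>Applied backwards, this executes the program symbolically; the word bound on the new
  configuration is handed on to the rest of the run.\<close>

lemma walk_step:
  assumes "fits_words w s" "pc s < 23" "no_overflow w (walk_program ! pc s) s"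
    "fits_words w (exec (walk_program ! pc s) s) \<Longrightarrow>
     ram_computes walk_program w t (exec (walk_program ! pc s) s) v"
  shows "ram_computes walk_program w (Suc t) s v"
  using assms fits_words_exec
  by (intro ram_computes_Suc) (auto simp: step_def halted_def)

section \<open>One round of the walk\<close>

text \<open>The address of the next node on the spine, or 0 at its end.\<close>

definition spine_child :: "(nat \<Rightarrow> nat) \<Rightarrow> nat \<Rightarrow> nat" where
  "spine_child m p = (if m p = 0 then m (Suc p) else m p)"

lemma represents_spine_child:
  assumes "skew s" "1 < size s" "represents m p s"
  obtains s' where "skew s'" "size s = Suc (size s')" "spine s = (m p = 0) # spine s'"
    "represents m (spine_child m p) s'" "spine_child m p \<noteq> 0"
proof -
  obtain l r where s: "s = Node l () r"
    using assms(2) by (cases s) auto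
  show thesis
  proof (cases "l = Leaf")
    case True
    with s assms(2) have "r \<noteq> Leaf"
      by auto
    then have "m (Suc p) \<noteq> 0"
      using s assms(3) represents_Leaf_iff [of m "m (Suc p)" r] by auto
    with True s assms that [of r] \<open>r \<noteq> Leaf\<close> show thesis
      by (auto simp: spine_child_def represents_Leaf_iff)
  next
    case False
    then have "m p \<noteq> 0"
      using s assms(3) represents_Leaf_iff [of m "m p" l] by auto
    with False s assms that [of l] show thesis
      by (auto simp: spine_child_def represents_Leaf_iff)
  qed
qed

text \<open>The last premise is the rest of the run from any registers with the stated values, so
  that blocks of code are chained by backward reasoning. A right turn takes 6 instructions, a left
  turn 4; the nonzero child excludes the exit.\<close>

lemma walk_first_tree:
  assumes "fits_words w \<lparr>pc = 2, reg = rg, mem = m\<rparr>" "rg 6 = 1" "rg 7 = 0"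
    "Suc (rg 0) < 2 ^ w" "Suc (rg 3) < 2 ^ w" "spine_child m (rg 0) \<noteq> 0"
    "\<And>a. m a < 2 ^ w"
    "\<And>rg'. fits_words w \<lparr>pc = 10, reg = rg', mem = m\<rparr> \<Longrightarrow>
       rg' 0 = spine_child m (rg 0) \<Longrightarrow> rg' 3 = rg 3 + of_bool (m (rg 0) = 0) \<Longrightarrow>
       (\<And>i. i \<notin> {0, 3, 5} \<Longrightarrow> rg' i = rg i) \<Longrightarrow>
       ram_computes walk_program w t \<lparr>pc = 10, reg = rg', mem = m\<rparr> v"
  shows "ram_computes walk_program w (t + 6) \<lparr>pc = 2, reg = rg, mem = m\<rparr> v"
proof (cases "m (rg 0) = 0")
  case True
  have "ram_computes walk_program w (Suc (Suc (Suc (Suc (Suc (Suc t))))))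
          \<lparr>pc = 2, reg = rg, mem = m\<rparr> v"
    using assms True
    by (intro walk_step) (auto simp: walk_program_def spine_child_def)
  then show ?thesis
    by (simp add: numeral_eq_Suc)
next
  case False
  have "ram_computes walk_program w (Suc (Suc (Suc (Suc t))))
          \<lparr>pc = 2, reg = rg, mem = m\<rparr> v"
    using assms False
    by (intro walk_step) (auto simp: walk_program_def spine_child_def)
  then show ?thesis
    by (rule ram_computes_mono) simp
qed

lemma walk_end:
  assumes "fits_words w \<lparr>pc = 2, reg = rg, mem = m\<rparr>" "rg 6 = 1" "rg 7 = 0"
    "Suc (rg 0) < 2 ^ w" "m (rg 0) = 0" "m (Suc (rg 0)) = 0"
  shows "ram_computes walk_program w 6 \<lparr>pc = 2, reg = rg, mem = m\<rparr> (rg 2)"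
proof -
  have "rg 2 < 2 ^ w"
    using assms(1) by (auto simp: fits_words_def)
  have "ram_computes walk_program w (Suc (Suc (Suc (Suc (Suc (Suc 0))))))
          \<lparr>pc = 2, reg = rg, mem = m\<rparr> (rg 2)"
    using assms \<open>rg 2 < 2 ^ w\<close>
    by (intro walk_step ram_computes_halted) (auto simp: walk_program_def halted_def)
  then show ?thesis
    by (simp add: numeral_eq_Suc)
qed

text \<open>There is no exit test here: for trees of equal size the one in the first tree serves
  both.\<close>

lemma walk_second_tree:
  assumes "fits_words w \<lparr>pc = 10, reg = rg, mem = m\<rparr>" "rg 6 = 1" "rg 7 = 0"
    "Suc (rg 1) < 2 ^ w" "Suc (rg 4) < 2 ^ w" "\<And>a. m a < 2 ^ w"
    "\<And>rg'. fits_words w \<lparr>pc = 17, reg = rg', mem = m\<rparr> \<Longrightarrow>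
       rg' 1 = spine_child m (rg 1) \<Longrightarrow> rg' 4 = rg 4 + of_bool (m (rg 1) = 0) \<Longrightarrow>
       (\<And>i. i \<notin> {1, 4, 5} \<Longrightarrow> rg' i = rg i) \<Longrightarrow>
       ram_computes walk_program w t \<lparr>pc = 17, reg = rg', mem = m\<rparr> v"
  shows "ram_computes walk_program w (t + 5) \<lparr>pc = 10, reg = rg, mem = m\<rparr> v"
proof (cases "m (rg 1) = 0")
  case True
  have "ram_computes walk_program w (Suc (Suc (Suc (Suc (Suc t)))))
          \<lparr>pc = 10, reg = rg, mem = m\<rparr> v"
    using assms True
    by (intro walk_step) (auto simp: walk_program_def spine_child_def)
  then show ?thesis
    by (simp add: numeral_eq_Suc)
next
  case False
  have "ram_computes walk_program w (Suc (Suc (Suc (Suc t))))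
          \<lparr>pc = 10, reg = rg, mem = m\<rparr> v"
    using assms False
    by (intro walk_step) (auto simp: walk_program_def spine_child_def)
  then show ?thesis
    by (rule ram_computes_mono) simp
qed

lemma walk_accumulate:
  assumes "fits_words w \<lparr>pc = 17, reg = rg, mem = m\<rparr>"
    "rg 2 + nat \<bar>int (rg 3) - int (rg 4)\<bar> < 2 ^ w"
    "\<And>rg'. fits_words w \<lparr>pc = 2, reg = rg', mem = m\<rparr> \<Longrightarrow>
       rg' 2 = rg 2 + nat \<bar>int (rg 3) - int (rg 4)\<bar> \<Longrightarrow>
       (\<And>i. i \<notin> {2, 5} \<Longrightarrow> rg' i = rg i) \<Longrightarrow>
       ram_computes walk_program w t \<lparr>pc = 2, reg = rg', mem = m\<rparr> v"
  shows "ram_computes walk_program w (t + 5) \<lparr>pc = 17, reg = rg, mem = m\<rparr> v"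
proof -
  have eq: "rg 2 + nat \<bar>int (rg 3) - int (rg 4)\<bar> = rg 2 + (rg 3 - rg 4) + (rg 4 - rg 3)"
    by linarith
  have "ram_computes walk_program w (Suc (Suc (Suc (Suc (Suc t)))))
          \<lparr>pc = 17, reg = rg, mem = m\<rparr> v"
    using assms(1) assms(2,3) [unfolded eq]
    by (intro walk_step) (auto simp: walk_program_def)
  then show ?thesis
    by (simp add: numeral_eq_Suc)
qed

text \<open>Here \<open>k\<close> counts the letters still to be read, hence bounds the future
  growth of both counters. The final value \<open>v\<close> is fixed through all rounds, so
  \<open>v < 2 ^ w\<close> bounds every partial sum.\<close>

lemma walk_loop:
  assumes "skew s1" "skew s2" "size s1 = Suc k" "size s2 = Suc k"
    "represents m (rg 0) s1" "represents m (rg 1) s2" "rg 6 = 1" "rg 7 = 0"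
    "fits_words w \<lparr>pc = 2, reg = rg, mem = m\<rparr>"
    "Suc (rg 0) < 2 ^ w" "Suc (rg 1) < 2 ^ w" "\<And>a. Suc (m a) < 2 ^ w"
    "rg 3 + k < 2 ^ w" "rg 4 + k < 2 ^ w"
    "v = rg 2 + profile_dist (int (rg 3) - int (rg 4)) (spine s1) (spine s2)" "v < 2 ^ w"
  shows "ram_computes walk_program w (16 * Suc k) \<lparr>pc = 2, reg = rg, mem = m\<rparr> v"
  using assms
proof (induction k arbitrary: s1 s2 rg)
  case 0
  then have "s1 = Node Leaf () Leaf"
    by (cases s1) auto
  with 0 have "ram_computes walk_program w 6 \<lparr>pc = 2, reg = rg, mem = m\<rparr> v"
    using walk_end [of w rg m] by auto
  then show ?case
    by (rule ram_computes_mono) simp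
next
  case (Suc k)
  define x y where "x = (m (rg 0) = 0)" and "y = (m (rg 1) = 0)"
  have "1 < size s1"
    using Suc.prems(3) by simp
  then obtain s1' where "skew s1'" "size s1 = Suc (size s1')" "spine s1 = x # spine s1'"
    "represents m (spine_child m (rg 0)) s1'" "spine_child m (rg 0) \<noteq> 0"
    unfolding x_def
    using represents_spine_child [OF Suc.prems(1) _ Suc.prems(5)] by blast
  with Suc.prems(3) have s1': "skew s1'" "size s1' = Suc k" "spine s1 = x # spine s1'"
    "represents m (spine_child m (rg 0)) s1'" "spine_child m (rg 0) \<noteq> 0"
    by auto
  have "1 < size s2"
    using Suc.prems(4) by simp
  then obtain s2' where "skew s2'" "size s2 = Suc (size s2')" "spine s2 = y # spine s2'"
    "represents m (spine_child m (rg 1)) s2'" "spine_child m (rg 1) \<noteq> 0"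
    unfolding y_def
    using represents_spine_child [OF Suc.prems(2) _ Suc.prems(6)] by blast
  with Suc.prems(4) have s2': "skew s2'" "size s2' = Suc k" "spine s2 = y # spine s2'"
    "represents m (spine_child m (rg 1)) s2'"
    by auto
  have m: "m a < 2 ^ w" for a
    using Suc.prems(12) [of a] by simp
  have child: "Suc (spine_child m p) < 2 ^ w" for p
    using Suc.prems(12) by (auto simp: spine_child_def)
  define d where "d = int (rg 3) - int (rg 4) + of_bool x - of_bool y"
  have v: "v = rg 2 + nat \<bar>d\<bar> + profile_dist d (spine s1') (spine s2')"
    using Suc.prems(15) s1' s2' by (simp add: d_def Let_def)
  \<comment> \<open>The 16 instructions of a round: at most 6 and 5 to advance in the two trees, and
    5 to accumulate.\<close>
  have "ram_computes walk_program w (16 * Suc k + 5 + 5 + 6) \<lparr>pc = 2, reg = rg, mem = m\<rparr> v"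
  proof (rule walk_first_tree)
    fix rg1
    assume 1: "fits_words w \<lparr>pc = 10, reg = rg1, mem = m\<rparr>"
      "rg1 0 = spine_child m (rg 0)" "rg1 3 = rg 3 + of_bool (m (rg 0) = 0)"
      "\<And>i. i \<notin> {0, 3, 5} \<Longrightarrow> rg1 i = rg i"
    show "ram_computes walk_program w (16 * Suc k + 5 + 5) \<lparr>pc = 10, reg = rg1, mem = m\<rparr> v"
    proof (rule walk_second_tree)
      fix rg2
      assume 2: "fits_words w \<lparr>pc = 17, reg = rg2, mem = m\<rparr>"
        "rg2 1 = spine_child m (rg1 1)" "rg2 4 = rg1 4 + of_bool (m (rg1 1) = 0)"
        "\<And>i. i \<notin> {1, 4, 5} \<Longrightarrow> rg2 i = rg1 i"
      have d: "int (rg2 3) - int (rg2 4) = d"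
        using 1 2 by (simp add: d_def x_def y_def)
      show "ram_computes walk_program w (16 * Suc k + 5) \<lparr>pc = 17, reg = rg2, mem = m\<rparr> v"
      proof (rule walk_accumulate)
        \<comment> \<open>The new partial sum is at most \<open>v\<close>, since the remaining
          summands are natural numbers.\<close>
        show "rg2 2 + nat \<bar>int (rg2 3) - int (rg2 4)\<bar> < 2 ^ w"
          unfolding d using 1(4) 2(4) v Suc.prems(16) by simp
      next
        fix rg3
        assume 3: "fits_words w \<lparr>pc = 2, reg = rg3, mem = m\<rparr>"
          "rg3 2 = rg2 2 + nat \<bar>int (rg2 3) - int (rg2 4)\<bar>"
          "\<And>i. i \<notin> {2, 5} \<Longrightarrow> rg3 i = rg2 i"
        show "ram_computes walk_program w (16 * Suc k) \<lparr>pc = 2, reg = rg3, mem = m\<rparr> v"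
        proof (rule Suc.IH [OF s1'(1) s2'(1) s1'(2) s2'(2)])
          show "v = rg3 2 + profile_dist (int (rg3 3) - int (rg3 4)) (spine s1') (spine s2')"
            using v d 1 2 3 by simp
          show "rg3 3 + k < 2 ^ w" "rg3 4 + k < 2 ^ w"
            using 1 2 3 Suc.prems(13,14) by auto
        qed (use 1 2 3 s1' s2' Suc.prems child in auto)
      qed (use 2 in auto)
    qed (use 1 Suc.prems m in auto)
  qed (use Suc.prems s1' m in auto)
  then show ?case
    by simp
qed

text \<open>The square covers both the addresses, which are linear in \<open>n\<close>, and the sum,
  which is at most quadratic.\<close>

lemma walk_program_computes:
  assumes "skew s1" "skew s2" "size s1 = n" "size s2 = n" "(4 * n + 4) ^ 2 < 2 ^ w"
  shows "ram_computes walk_program w (16 * n + 2) (input_config s1 s2)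
           (profile_dist 0 (spine s1) (spine s2))"
proof -
  define m where "m = mem (input_config s1 s2)"
  define rg where "rg = reg (input_config s1 s2)"
  have input: "input_config s1 s2 = \<lparr>pc = 0, reg = rg, mem = m\<rparr>"
    by (simp add: m_def rg_def input_config_def Let_def)
  have "4 * n + 4 \<le> (4 * n + 4) ^ 2"
    by (simp add: power2_eq_square)
  with assms(5) have bound: "4 * n + 4 < 2 ^ w"
    by linarith
  let ?cs = "[0] @ cells 1 s1 @ cells (1 + 2 * n) s2"
  have m_eq: "m = (\<lambda>a. if a < length ?cs then ?cs ! a else 0)"
    using assms by (auto simp: m_def input_config_def Let_def)
  have "\<forall>x \<in> set ?cs. x < 4 * n + 1"
    using cells_less [of _ 1 s1] cells_less [of _ "1 + 2 * n" s2] assms by fastforce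
  then have m_less: "m a < 4 * n + 1" for a
    unfolding m_eq by (metis nth_mem zero_less_Suc Suc_eq_plus1)
  have rg_eq: "rg = (\<lambda>_. 0)(0 := root_ptr 1 s1, 1 := root_ptr (1 + 2 * n) s2)"
    using assms by (simp add: rg_def input_config_def Let_def)
  have root1: "represents m (root_ptr 1 s1) s1"
    using assms by (intro represents_cells) (auto simp: m_eq nth_append)
  have root2: "represents m (root_ptr (1 + 2 * n) s2) s2"
    using assms by (intro represents_cells) (auto simp: m_eq nth_append)
  have rg_less: "rg i < 2 * n + 2" for i
    by (auto simp: rg_eq root_ptr_def)
  have fits: "fits_words w \<lparr>pc = i, reg = rg, mem = m\<rparr>" for i
  proof -
    have "rg j < 2 ^ w" "m a < 2 ^ w" for j a
      using rg_less [of j] m_less [of a] bound by linarith+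
    then show ?thesis
      by (simp add: fits_words_def)
  qed
  show ?thesis
  proof (cases n)
    case 0
    with assms have "s1 = Leaf" "s2 = Leaf"
      by simp_all
    then have "ram_computes walk_program w (Suc (Suc 0)) \<lparr>pc = 0, reg = rg, mem = m\<rparr> 0"
      using fits [of 0] bound
      by (intro walk_step ram_computes_halted)
         (auto simp: walk_program_def halted_def rg_eq root_ptr_def)
    with 0 \<open>s1 = Leaf\<close> show ?thesis
      by (simp add: numeral_eq_Suc flip: input)
  next
    case (Suc k)
    let ?d = "profile_dist 0 (spine s1) (spine s2)"
    have "length (spine s1) = k"
      using assms Suc by (simp add: length_spine)
    then have "?d \<le> k * k"
      using profile_dist_le [of 0 "spine s1" k "spine s2"] by simp
    also have "k * k \<le> (4 * n + 4) ^ 2"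
      unfolding power2_eq_square by (intro mult_mono) (auto simp: Suc)
    finally have d: "?d < 2 ^ w"
      using assms(5) by simp
    have "s1 \<noteq> Leaf"
      using assms Suc by auto
    have "ram_computes walk_program w (16 * Suc k) \<lparr>pc = 2, reg = rg(6 := 1), mem = m\<rparr> ?d"
    proof (rule walk_loop [OF assms(1,2)])
      show "fits_words w \<lparr>pc = 2, reg = rg(6 := 1), mem = m\<rparr>"
        using fits [of 2] bound by (auto simp: fits_words_def)
      show "Suc (m a) < 2 ^ w" for a
        using m_less [of a] bound by linarith
    qed (use assms Suc root1 root2 bound d rg_less [of 0] rg_less [of 1] in
         \<open>auto simp: rg_eq\<close>)
    \<comment> \<open>The two extra instructions are the test for empty trees and the loading of the
      constant 1.\<close>
    then have "ram_computes walk_program w (Suc (Suc (16 * Suc k))) \<lparr>pc = 0, reg = rg, mem = m\<rparr> ?d"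
      using fits [of 0] bound \<open>s1 \<noteq> Leaf\<close>
      by (intro walk_step) (auto simp: walk_program_def rg_eq root_ptr_def numeral_eq_Suc)
    then show ?thesis
      by (simp add: input Suc)
  qed
qed

section \<open>A sufficient word length\<close>

text \<open>From \<open>(4 * n + 4) ^ 2 = 16 * (n + 1) ^ 2\<close>: 4 bits for the factor 16, twice
  the logarithm for the square, and one bit to make the bound strict.\<close>

definition word_length :: "nat \<Rightarrow> nat" where
  "word_length n = 5 + 2 * nat \<lceil>log 2 (real (n + 1))\<rceil>"

lemma word_length_sufficient: "(4 * n + 4) ^ 2 < 2 ^ word_length n"
proof -
  define k where "k = nat \<lceil>log 2 (real (n + 1))\<rceil>"
  have "log 2 (real (n + 1)) \<le> real k"
    unfolding k_def by (rule real_nat_ceiling_ge)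
  then have "real (n + 1) \<le> 2 powr real k"
    by (subst (asm) log_le_iff) auto
  then have "n + 1 \<le> 2 ^ k"
    by (simp add: powr_realpow flip: of_nat_le_iff [where ?'a = real])
  then have "16 * (n + 1) ^ 2 \<le> 16 * (2 ^ k) ^ 2"
    by (intro mult_le_mono2 power_mono) auto
  also have "(2 ^ k) ^ 2 = (4 :: nat) ^ k"
    by (simp add: power2_eq_square flip: power_mult_distrib)
  also have "16 * 4 ^ k < (2 :: nat) ^ word_length n"
    unfolding word_length_def k_def [symmetric] by (simp add: power_add power_mult)
  finally show ?thesis
    by (simp add: power2_eq_square algebra_simps)
qed

lemma word_length_bigo: "(\<lambda>n. real (word_length n)) \<in> O(\<lambda>n. ln (real n))"
proof (rule landau_o.big_trans)
  \<comment> \<open>Rounding up adds at most 1 to the logarithm, so the constant grows from 5 to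
    7.\<close>
  have "real (word_length n) \<le> 7 + 2 * log 2 (real n + 1)" for n
  proof -
    have "0 \<le> log 2 (real n + 1)"
      by simp
    then show ?thesis
      unfolding word_length_def by (simp add: add.commute) linarith
  qed
  then show "(\<lambda>n. real (word_length n)) \<in> O(\<lambda>n. 7 + 2 * log 2 (real n + 1))"
    by (intro landau_o.big_mono always_eventually allI) (auto intro: order_trans)
  show "(\<lambda>n. 7 + 2 * log 2 (real n + 1)) \<in> O(\<lambda>n. ln (real n))"
    unfolding log_def by real_asymp
qed

theorem theorem2:
  "\<exists>(P :: program) (T :: nat \<Rightarrow> nat) (w :: nat \<Rightarrow> nat).
     (\<lambda>n. real (T n)) \<in> O(\<lambda>n. real n ^ 2) \<and>
     (\<lambda>n. real (w n)) \<in> O(\<lambda>n. ln (real n)) \<and>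
     (\<forall>(n :: nat) (T1 :: full_tree) (T2 :: full_tree).
        skew T1 \<and> skew T2 \<and> size T1 = n \<and> size T2 = n \<longrightarrow>
        (\<exists>d :: nat. skew_rotation_distance T1 T2 = enat d \<and>
                    ram_computes P (w n) (T n) (input_config T1 T2) d))"
proof (intro exI conjI allI impI)
  \<comment> \<open>The machine is even linear, well within the quadratic bound.\<close>
  show "(\<lambda>n. real (16 * n + 2)) \<in> O(\<lambda>n. real n ^ 2)"
    by real_asymp
  show "(\<lambda>n. real (word_length n)) \<in> O(\<lambda>n. ln (real n))"
    by (rule word_length_bigo)
  fix n :: nat and T1 T2 :: full_tree
  assume T: "skew T1 \<and> skew T2 \<and> size T1 = n \<and> size T2 = n"
  show "skew_rotation_distance T1 T2 = enat (profile_dist 0 (spine T1) (spine T2))"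
    using T by (intro skew_rotation_distance_eq) auto
  show "ram_computes walk_program (word_length n) (16 * n + 2) (input_config T1 T2)
          (profile_dist 0 (spine T1) (spine T2))"
    using T word_length_sufficient by (intro walk_program_computes) auto
qed

end
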